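(* Let $b:\mathbb R^d\to\mathbb R^d$, $\sigma:\mathbb R^d\to\mathbb R^{d\times D}$ satisfy: (A1) there are $L_1,L_2>0$ with $\|\sigma(u_1)-\sigma(u_2)\|_{HS}\le L_1|u_1-u_2|$ and $\|\sigma(u)\|_{HS}\le L_2$ for all $u,u_1,u_2\in\mathbb R^d$; (A2) there are $c_1>\frac{15}{2}L_1^2$, $L_3>0$, $q\ge1$ with $\langle u_1-u_2,b(u_1)-b(u_2)\rangle\le -c_1|u_1-u_2|^2$ and $|b(u_1)-b(u_2)|\le L_3(1+|u_1|^{q-1}+|u_2|^{q-1})|u_1-u_2|$ for all $u_1,u_2$. Let $W$ be a $D$-dimensional standard Brownian motion, $\tau>0$, and $\bar X^x_n$ the backward Euler--Maruyama approximation $\bar X_{n+1}=\bar X_n+b(\bar X_{n+1})\tau+\sigma(\bar X_n)\Delta W_n$, $\Delta W_n=W((n+1)\tau)-W(n\tau)$, $\bar X_0=x\in\mathbb R^d$. Then for any $r\ge1$ there is $K(r)>0$ independent of $\tau$ and $x$ such that for all $\tau\le1$ and $x\in\mathbb R^d$, $$\sup_{n\ge0}\mathbf E|\bar X^x_n|^r\le K(r)(1+|x|^r).$$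
   Context: $|\cdot|$ is the Euclidean norm and $\|\cdot\|_{HS}$ the Hilbert--Schmidt norm. *)

theory Defs
  imports "HOL-Probability.Probability"
begin

definition hs_norm :: "real^'m^'n \<Rightarrow> real" where
  "hs_norm A = sqrt (\<Sum>i\<in>UNIV. \<Sum>j\<in>UNIV. (A $ i $ j)^2)"

text \<open>Real power with the convention that the exponent 0 gives 1 (also at base 0).\<close>
definition rpow :: "real \<Rightarrow> real \<Rightarrow> real" where
  "rpow x a = (if a = 0 then 1 else x powr a)"

definition std_brownian_motion :: "'a measure \<Rightarrow> (real \<Rightarrow> 'a \<Rightarrow> real^'m) \<Rightarrow> bool" where
  "std_brownian_motion M W \<longleftrightarrow>
     prob_space M \<and>
     (\<forall>t\<ge>0. W t \<in> borel_measurable M) \<and>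
     (\<forall>\<omega>\<in>space M. W 0 \<omega> = 0) \<and>
     (\<forall>\<omega>\<in>space M. continuous_on {0..} (\<lambda>t. W t \<omega>)) \<and>
     (\<forall>s t. 0 \<le> s \<and> s < t \<longrightarrow>
        distributed M lborel (\<lambda>\<omega>. W t \<omega> - W s \<omega>)
          (\<lambda>v. ennreal (\<Prod>j\<in>UNIV. normal_density 0 (sqrt (t - s)) (v $ j)))) \<and>
     (\<forall>(n::nat) (tt::nat \<Rightarrow> real). 0 \<le> tt 0 \<and> (\<forall>i<n. tt i < tt (Suc i)) \<longrightarrow>
        prob_space.indep_vars M (\<lambda>_. borel) (\<lambda>i \<omega>. W (tt (Suc i)) \<omega> - W (tt i) \<omega>) {..<n})"

end

theory Submission
  imports Defs
begin

text \<open>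
  Put $V_n = 1 + |X_n|^2$. Dissipativity of $b$ gives
  $(1 + c\tau) V_{n+1} \le 1 + |X_n + \sigma(X_n) \Delta W_n|^2 + \tau B$.
  Raise this to the power $m$. Since $\Delta W_n$ is symmetric, the right-hand side may be
  replaced in expectation by its average over $\pm\Delta W_n$, and only the even part of the power
  in $w = \sigma(X_n) \Delta W_n$ survives; it is at most $(V_n + \tau B + (4m+1)|w|^2)^m$.
  As $|w|^2 \le \tau L^2 |Z|^2$ with $Z$ standard normal and $V_n \ge 1$, the expectation given
  $X_n$ is at most $V_n^m + \tau K V_n^{m-1}$. With $y = 2K/c$, so that
  $K V_n^{m-1} \le \frac{c}{2}(V_n^m + y^m)$,
  \[ (1 + c\tau) \mathbf{E} V_{n+1}^m
    \le (1 + \frac{c}{2}\tau) \mathbf{E} V_n^m + \frac{c}{2}\tau y^m, \]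
  whence $\mathbf{E} V_n^m \le V_0^m + y^m$. Other exponents $r \le 2m$ follow from
  $t^r \le l^{r-2m} (1+t^2)^m + l^r$ with $l = 1 + |x|$.
\<close>

section \<open>Power inequalities\<close>

lemma power_even_odd_part_le:
  fixes P Q \<alpha> s :: real
  assumes P: "0 \<le> P" and s: "0 \<le> s" and \<alpha>: "\<alpha>\<^sup>2 \<le> P * s" and Q: "P + real m * s \<le> Q"
  shows "(P + \<alpha>) ^ m + (P - \<alpha>) ^ m \<le> 2 * Q ^ m
    \<and> \<alpha> * ((P + \<alpha>) ^ m - (P - \<alpha>) ^ m) \<le> 2 * (real m * s * Q ^ m)"
    (is "?even m \<le> _ \<and> \<alpha> * ?odd m \<le> _")
  using Q
proof (induction m)
  case (Suc m)
  then have Q: "P + real m * s \<le> Q"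
    using s by (simp add: distrib_right)
  then have even: "?even m \<le> 2 * Q ^ m" and odd: "\<alpha> * ?odd m \<le> 2 * (real m * s * Q ^ m)"
    using Suc.IH by simp_all
  have PQ: "P \<le> Q" and Q_nonneg: "0 \<le> Q"
    using P mult_nonneg_nonneg[of "real m" s] s Q by linarith+
  have "?even (Suc m) = P * ?even m + \<alpha> * ?odd m"
    by (simp add: algebra_simps)
  also have "\<dots> \<le> P * (2 * Q ^ m) + 2 * (real m * s * Q ^ m)"
    using P even odd by (intro add_mono mult_left_mono)
  also have "\<dots> = 2 * ((P + real m * s) * Q ^ m)"
    by (simp add: algebra_simps)
  also have "\<dots> \<le> 2 * (Q * Q ^ m)"
    using Q Q_nonneg by (intro mult_left_mono mult_right_mono) auto
  finally have "?even (Suc m) \<le> 2 * Q ^ Suc m" by simp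
  moreover have "\<alpha> * ?odd (Suc m) \<le> 2 * (real (Suc m) * s * Q ^ Suc m)"
  proof -
    have "\<alpha>\<^sup>2 * ?even m \<le> \<alpha>\<^sup>2 * (2 * Q ^ m)"
      using even by (intro mult_left_mono) auto
    also have "\<dots> \<le> (P * s) * (2 * Q ^ m)"
      using \<alpha> Q_nonneg by (intro mult_right_mono) auto
    finally have "P * (\<alpha> * ?odd m) + \<alpha>\<^sup>2 * ?even m
        \<le> P * (2 * (real m * s * Q ^ m)) + (P * s) * (2 * Q ^ m)"
      using P odd by (intro add_mono mult_left_mono)
    also have "\<dots> = 2 * (real (Suc m) * s * (P * Q ^ m))"
      by (simp add: algebra_simps)
    also have "\<dots> \<le> 2 * (real (Suc m) * s * (Q * Q ^ m))"
      using PQ Q_nonneg s by (intro mult_left_mono mult_right_mono) auto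
    finally show ?thesis
      by (simp add: algebra_simps power2_eq_square)
  qed
  ultimately show ?case ..
qed simp

lemma power_even_part_le:
  fixes P \<alpha> s :: real
  assumes "0 \<le> P" "0 \<le> s" "\<alpha>\<^sup>2 \<le> P * s"
  shows "(P + \<alpha>) ^ m + (P - \<alpha>) ^ m \<le> 2 * (P + real m * s) ^ m"
  using power_even_odd_part_le[OF assms order.refl] by blast

lemma norm_add_diff_power_le:
  fixes u w :: "'a::real_inner"
  assumes \<beta>: "0 \<le> \<beta>"
  shows "(\<beta> + (norm (u + w))\<^sup>2) ^ m + (\<beta> + (norm (u - w))\<^sup>2) ^ m
    \<le> 2 * (\<beta> + (norm u)\<^sup>2 + (4 * real m + 1) * (norm w)\<^sup>2) ^ m"
proof -
  define P where "P = \<beta> + (norm u)\<^sup>2 + (norm w)\<^sup>2"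
  define \<alpha> where "\<alpha> = 2 * (u \<bullet> w)"
  have "\<bar>u \<bullet> w\<bar>\<^sup>2 \<le> (norm u * norm w)\<^sup>2"
    by (intro power_mono Cauchy_Schwarz_ineq2) auto
  then have "\<alpha>\<^sup>2 \<le> (norm u)\<^sup>2 * (4 * (norm w)\<^sup>2)"
    by (simp add: \<alpha>_def power_mult_distrib)
  also have "\<dots> \<le> P * (4 * (norm w)\<^sup>2)"
    using \<beta> by (intro mult_right_mono) (auto simp: P_def)
  finally have "(P + \<alpha>) ^ m + (P - \<alpha>) ^ m \<le> 2 * (P + real m * (4 * (norm w)\<^sup>2)) ^ m"
    using \<beta> by (intro power_even_part_le) (auto simp: P_def)
  moreover have "\<beta> + (norm (u + w))\<^sup>2 = P + \<alpha>" "\<beta> + (norm (u - w))\<^sup>2 = P - \<alpha>"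
    by (simp_all add: P_def \<alpha>_def power2_norm_eq_inner inner_add_left inner_add_right
        inner_diff_left inner_diff_right inner_commute)
  moreover have "P + real m * (4 * (norm w)\<^sup>2) = \<beta> + (norm u)\<^sup>2 + (4 * real m + 1) * (norm w)\<^sup>2"
    by (simp add: P_def algebra_simps)
  ultimately show ?thesis by simp
qed

lemma power_add_small_le:
  fixes V H \<tau> :: real
  assumes V: "1 \<le> V" and H: "0 \<le> H" and \<tau>: "0 \<le> \<tau>" "\<tau> \<le> 1"
  shows "(V + \<tau> * H) ^ Suc k \<le> V ^ Suc k + \<tau> * V ^ k * (1 + H) ^ Suc k"
proof -
  have "(V + \<tau> * H) ^ Suc k \<le> V ^ Suc k + \<tau> * V ^ k * ((1 + H) ^ Suc k - 1)"
  proof (induction k)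
    case (Suc k)
    define G where "G = (1 + H) ^ Suc k - 1"
    have G: "0 \<le> G" using H by (simp add: G_def del: power_Suc)
    have "(V + \<tau> * H) ^ Suc (Suc k) \<le> (V + \<tau> * H) * (V ^ Suc k + \<tau> * V ^ k * G)"
      unfolding power_Suc[of _ "Suc k"] using V H \<tau> Suc by (intro mult_left_mono) (auto simp: G_def)
    also have "\<dots> = V ^ Suc (Suc k) + \<tau> * V ^ Suc k * (G + H) + \<tau> * V ^ k * (H * G) * \<tau>"
      by (simp add: algebra_simps)
    also have "\<dots> \<le> V ^ Suc (Suc k) + \<tau> * V ^ Suc k * (G + H) + \<tau> * V ^ k * (H * G) * V"
      using V H G \<tau> by (intro add_left_mono mult_left_mono) auto
    also have "\<dots> = V ^ Suc (Suc k) + \<tau> * V ^ Suc k * ((1 + H) ^ Suc (Suc k) - 1)"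
      by (simp add: G_def algebra_simps)
    finally show ?case .
  qed simp
  also have "\<dots> \<le> V ^ Suc k + \<tau> * V ^ k * (1 + H) ^ Suc k"
    using V \<tau> by (intro add_left_mono mult_left_mono) auto
  finally show ?thesis .
qed

lemma symmetrized_increment_power_le:
  fixes u w :: "'a::real_inner"
  assumes \<tau>: "0 \<le> \<tau>" "\<tau> \<le> 1" and B: "0 \<le> B" and w: "(norm w)\<^sup>2 \<le> \<tau> * h" and h: "0 \<le> h"
  shows "(1 + (norm (u + w))\<^sup>2 + \<tau> * B) ^ Suc k + (1 + (norm (u - w))\<^sup>2 + \<tau> * B) ^ Suc k
    \<le> 2 * ((1 + (norm u)\<^sup>2) ^ Suc k
        + \<tau> * (1 + (norm u)\<^sup>2) ^ k * (1 + B + (4 * real (Suc k) + 1) * h) ^ Suc k)"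
proof -
  let ?a = "4 * real (Suc k) + 1"
  define V where "V = 1 + (norm u)\<^sup>2"
  have "(1 + (norm (u + w))\<^sup>2 + \<tau> * B) ^ Suc k + (1 + (norm (u - w))\<^sup>2 + \<tau> * B) ^ Suc k
      \<le> 2 * (V + \<tau> * B + ?a * (norm w)\<^sup>2) ^ Suc k"
    using norm_add_diff_power_le[of "1 + \<tau> * B" u w "Suc k"] \<tau> B
    by (simp add: V_def ac_simps del: power_Suc)
  also have "\<dots> \<le> 2 * (V + \<tau> * B + ?a * (\<tau> * h)) ^ Suc k"
    using \<tau> B w by (intro mult_left_mono power_mono add_left_mono) (auto simp: V_def)
  also have "V + \<tau> * B + ?a * (\<tau> * h) = V + \<tau> * (B + ?a * h)"
    by (simp add: algebra_simps)
  also have "(V + \<tau> * (B + ?a * h)) ^ Suc k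
      \<le> V ^ Suc k + \<tau> * V ^ k * (1 + (B + ?a * h)) ^ Suc k"
    using \<tau> B h by (intro power_add_small_le) (auto simp: V_def)
  finally show ?thesis by (simp add: V_def add.assoc del: power_Suc)
qed

lemma mult_power_le_power_Suc_add:
  fixes x y :: "'a::linordered_semidom"
  assumes "0 \<le> x" "0 \<le> y"
  shows "x * y ^ k \<le> x ^ Suc k + y ^ Suc k"
proof (cases "x \<le> y")
  case True
  then have "x * y ^ k \<le> y ^ Suc k" using assms by (simp add: mult_right_mono)
  then show ?thesis using assms by (simp add: add_increasing)
next
  case False
  then have "x * y ^ k \<le> x ^ Suc k" using assms by (simp add: mult_left_mono power_mono)
  then show ?thesis using assms by (simp add: add_increasing2)
qed

lemma one_plus_powr_le:
  fixes t r :: real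
  assumes "0 \<le> t" "0 \<le> r"
  shows "(1 + t) powr r \<le> 2 powr r * (1 + t powr r)"
proof -
  have "(1 + t) powr r \<le> (2 * max 1 t) powr r"
    using assms by (intro powr_mono2) auto
  also have "\<dots> = 2 powr r * max 1 t powr r" by (simp add: powr_mult)
  also have "max 1 t powr r \<le> 1 + t powr r" by (simp add: max_def)
  finally show ?thesis by simp
qed

lemma powr_le_even_power:
  fixes t l r :: real
  assumes t: "0 \<le> t" and l: "1 \<le> l" and r: "0 \<le> r" "r \<le> 2 * real m"
  shows "t powr r \<le> l powr (r - 2 * real m) * (1 + t\<^sup>2) ^ m + l powr r"
proof (cases "t \<le> l")
  case True
  then have "t powr r \<le> l powr r" using t r by (intro powr_mono2) auto
  also have "\<dots> \<le> l powr (r - 2 * real m) * (1 + t\<^sup>2) ^ m + l powr r" by simp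
  finally show ?thesis .
next
  case False
  have "t powr r = t powr (r - 2 * real m) * t powr (2 * real m)"
    by (simp add: powr_add[symmetric])
  also have "t powr (2 * real m) = (t\<^sup>2) ^ m"
    using False l powr_realpow[of t "2 * m"] by (simp add: power_mult)
  also have "t powr (r - 2 * real m) * (t\<^sup>2) ^ m \<le> l powr (r - 2 * real m) * (1 + t\<^sup>2) ^ m"
    using False l r by (intro mult_mono powr_mono2' power_mono) auto
  also have "\<dots> \<le> \<dots> + l powr r" by simp
  finally show ?thesis .
qed

section \<open>Dissipative and polynomially Lipschitz vector fields\<close>

definition strongly_dissipative :: "real \<Rightarrow> ('a::real_inner \<Rightarrow> 'a) \<Rightarrow> bool" where
  "strongly_dissipative c b \<longleftrightarrow> (\<forall>u v. (u - v) \<bullet> (b u - b v) \<le> - c * (norm (u - v))\<^sup>2)"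

definition dissipation_offset :: "real \<Rightarrow> ('a::real_inner \<Rightarrow> 'a) \<Rightarrow> real" where
  "dissipation_offset c b = (norm (b 0))\<^sup>2 / c + c"

lemma dissipation_offset_nonneg: "0 \<le> c \<Longrightarrow> 0 \<le> dissipation_offset c b"
  by (simp add: dissipation_offset_def)

lemma strongly_dissipative_inner_le:
  assumes c: "0 < c" and diss: "strongly_dissipative c b"
  shows "2 * (u \<bullet> b u) \<le> (norm (b 0))\<^sup>2 / c - c * (norm u)\<^sup>2"
proof -
  have "2 * (u \<bullet> b 0) \<le> 2 * (norm u * norm (b 0))"
    using norm_cauchy_schwarz[of u "b 0"] by simp
  also have "\<dots> \<le> c * (norm u)\<^sup>2 + (norm (b 0))\<^sup>2 / c"
  proof -
    have "0 \<le> (c * norm u - norm (b 0))\<^sup>2 / c" using c by simp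
    also have "\<dots> = c * (norm u)\<^sup>2 - 2 * (norm u * norm (b 0)) + (norm (b 0))\<^sup>2 / c"
      using c by (simp add: power2_diff power_mult_distrib field_simps power2_eq_square)
    finally show ?thesis by simp
  qed
  finally have "2 * (u \<bullet> b 0) \<le> c * (norm u)\<^sup>2 + (norm (b 0))\<^sup>2 / c" .
  moreover have "u \<bullet> (b u - b 0) \<le> - c * (norm u)\<^sup>2"
    using diss[unfolded strongly_dissipative_def, rule_format, of u 0] by simp
  ultimately show ?thesis
    by (simp add: inner_diff_right)
qed

lemma strongly_dissipative_implicit_step_le:
  assumes c: "0 < c" and \<tau>: "0 \<le> \<tau>" and diss: "strongly_dissipative c b"
  shows "(1 + c * \<tau>) * (1 + (norm u)\<^sup>2)
    \<le> 1 + (norm (u - \<tau> *\<^sub>R b u))\<^sup>2 + \<tau> * dissipation_offset c b"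
proof -
  have "\<tau> * (2 * (u \<bullet> b u)) \<le> \<tau> * ((norm (b 0))\<^sup>2 / c - c * (norm u)\<^sup>2)"
    by (intro mult_left_mono strongly_dissipative_inner_le c diss \<tau>)
  moreover have "(norm (u - \<tau> *\<^sub>R b u))\<^sup>2 = (norm u)\<^sup>2 - \<tau> * (2 * (u \<bullet> b u)) + \<tau>\<^sup>2 * (norm (b u))\<^sup>2"
    unfolding power2_norm_eq_inner
    by (simp add: inner_diff_left inner_diff_right inner_commute power2_eq_square)
  moreover have "0 \<le> \<tau>\<^sup>2 * (norm (b u))\<^sup>2" by simp
  ultimately have "(norm u)\<^sup>2 - \<tau> * ((norm (b 0))\<^sup>2 / c - c * (norm u)\<^sup>2)
      \<le> (norm (u - \<tau> *\<^sub>R b u))\<^sup>2"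
    by linarith
  then show ?thesis by (simp add: dissipation_offset_def algebra_simps)
qed

lemma strongly_dissipative_implicit_step_inj:
  assumes c: "0 \<le> c" and \<tau>: "0 \<le> \<tau>" and diss: "strongly_dissipative c b"
  shows "inj (\<lambda>u. u - \<tau> *\<^sub>R b u)"
proof (rule injI)
  fix u v assume "u - \<tau> *\<^sub>R b u = v - \<tau> *\<^sub>R b v"
  then have "u - v = \<tau> *\<^sub>R (b u - b v)" by (simp add: algebra_simps)
  then have "(norm (u - v))\<^sup>2 = \<tau> * ((u - v) \<bullet> (b u - b v))"
    unfolding power2_norm_eq_inner by (metis inner_scaleR_right)
  also have "\<dots> \<le> \<tau> * (- c * (norm (u - v))\<^sup>2)"
    using diss \<tau> by (intro mult_left_mono) (auto simp: strongly_dissipative_def)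
  also have "\<dots> \<le> 0" using c \<tau> by simp
  finally show "u = v" by simp
qed

lemma continuous_on_rpow:
  assumes "0 \<le> a"
  shows "continuous_on {0..} (\<lambda>x. rpow x a)"
proof (cases "a = 0")
  case False
  then have "continuous_on {0..} (\<lambda>x. x powr a)"
    using assms by (intro continuous_on_powr') (auto intro: continuous_intros)
  with False show ?thesis by (simp add: rpow_def)
qed (simp add: rpow_def)

lemma continuous_on_polynomially_lipschitz:
  fixes b :: "'a::real_normed_vector \<Rightarrow> 'b::real_normed_vector"
  assumes a: "0 \<le> a"
    and lip: "\<And>u v. norm (b u - b v) \<le> L * (1 + rpow (norm u) a + rpow (norm v) a) * norm (u - v)"
  shows "continuous_on UNIV b"
proof -
  have "isCont b v" for v
  proof -
    let ?bound = "\<lambda>u. L * (1 + rpow (norm u) a + rpow (norm v) a) * norm (u - v)"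
    have "continuous_on UNIV ?bound"
      by (intro continuous_intros continuous_on_compose2[OF continuous_on_rpow[OF a]]) auto
    then have "isCont ?bound v"
      by (simp add: continuous_on_eq_continuous_at)
    then have "(?bound \<longlongrightarrow> 0) (at v)"
      by (simp add: isCont_def)
    then have "((\<lambda>u. b u - b v) \<longlongrightarrow> 0) (at v)"
      by (rule Lim_null_comparison[rotated]) (simp add: lip)
    then show ?thesis by (simp add: isCont_def LIM_zero_iff)
  qed
  then show ?thesis by (simp add: continuous_at_imp_continuous_on)
qed

section \<open>Symmetric noise\<close>

locale symmetric_distribution = prob_space \<nu> for \<nu> :: "'b::euclidean_space measure" +
  assumes sets_eq_borel [simp, measurable_cong]: "sets \<nu> = sets borel"
    and distr_uminus: "distr \<nu> borel uminus = \<nu>"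
begin

lemma nn_integral_uminus:
  assumes [measurable]: "f \<in> borel_measurable borel"
  shows "(\<integral>\<^sup>+z. f (- z) \<partial>\<nu>) = (\<integral>\<^sup>+z. f z \<partial>\<nu>)"
  by (subst (2) distr_uminus[symmetric]) (simp add: nn_integral_distr)

end

definition noise_moment :: "'b::real_normed_vector measure \<Rightarrow> real \<Rightarrow> real \<Rightarrow> nat \<Rightarrow> ennreal" where
  "noise_moment \<nu> B L m = (\<integral>\<^sup>+z. ennreal ((1 + B + (4 * real m + 1) * (L * norm z)\<^sup>2) ^ m) \<partial>\<nu>)"

lemma norm_linear_scaled_le:
  assumes A: "linear A" "\<And>z. norm (A z) \<le> L * norm z" and \<tau>: "0 \<le> \<tau>"
  shows "(norm (A (sqrt \<tau> *\<^sub>R z)))\<^sup>2 \<le> \<tau> * (L * norm z)\<^sup>2"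
proof -
  have "(norm (A z))\<^sup>2 \<le> (L * norm z)\<^sup>2"
    by (intro power_mono A(2)) auto
  then show ?thesis
    using \<tau> by (simp add: linear_cmul[OF A(1)] power_mult_distrib mult_left_mono)
qed

lemma (in symmetric_distribution) linear_increment_moment_le:
  fixes u :: "'a::euclidean_space"
  assumes \<tau>: "0 \<le> \<tau>" "\<tau> \<le> 1" and B: "0 \<le> B"
    and A: "linear A" "\<And>z. norm (A z) \<le> L * norm z"
  shows "(\<integral>\<^sup>+z. ennreal ((1 + (norm (u + A (sqrt \<tau> *\<^sub>R z)))\<^sup>2 + \<tau> * B) ^ Suc k) \<partial>\<nu>)
    \<le> ennreal ((1 + (norm u)\<^sup>2) ^ Suc k)
        + ennreal (\<tau> * (1 + (norm u)\<^sup>2) ^ k) * noise_moment \<nu> B L (Suc k)"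
    (is "(\<integral>\<^sup>+z. ?h z \<partial>\<nu>) \<le> ?V + ?T * _")
proof -
  let ?H = "\<lambda>z. (1 + B + (4 * real (Suc k) + 1) * (L * norm z)\<^sup>2) ^ Suc k"
  have [measurable]: "A \<in> borel_measurable borel"
    using A(1) by (intro borel_measurable_continuous_onI linear_continuous_on)
      (simp add: linear_conv_bounded_linear)
  have pointwise: "?h z + ?h (- z) \<le> 2 * (?V + ?T * ennreal (?H z))" for z
  proof -
    define w where "w = A (sqrt \<tau> *\<^sub>R z)"
    have "(norm w)\<^sup>2 \<le> \<tau> * (L * norm z)\<^sup>2"
      unfolding w_def by (rule norm_linear_scaled_le[OF A \<tau>(1)])
    from ennreal_leI[OF symmetrized_increment_power_le[OF \<tau> B this, of u k]]
    have "ennreal ((1 + (norm (u + w))\<^sup>2 + \<tau> * B) ^ Suc k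
          + (1 + (norm (u - w))\<^sup>2 + \<tau> * B) ^ Suc k)
        \<le> ennreal (2 * ((1 + (norm u)\<^sup>2) ^ Suc k + \<tau> * (1 + (norm u)\<^sup>2) ^ k * ?H z))"
      by simp
    moreover have "A (sqrt \<tau> *\<^sub>R (- z)) = - w"
      by (simp only: w_def scaleR_minus_right linear_neg[OF A(1)])
    ultimately show ?thesis
      using \<tau> B by (simp add: w_def[symmetric] ennreal_mult ennreal_plus del: power_Suc)
  qed
  have "(\<integral>\<^sup>+z. ?h (- z) \<partial>\<nu>) = (\<integral>\<^sup>+z. ?h z \<partial>\<nu>)"
    by (rule nn_integral_uminus) measurable
  then have "2 * (\<integral>\<^sup>+z. ?h z \<partial>\<nu>) = (\<integral>\<^sup>+z. ?h z + ?h (- z) \<partial>\<nu>)"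
    by (subst nn_integral_add) (simp_all only: mult_2, measurable)
  also have "\<dots> \<le> (\<integral>\<^sup>+z. 2 * (?V + ?T * ennreal (?H z)) \<partial>\<nu>)"
    by (intro nn_integral_mono pointwise)
  also have "\<dots> = 2 * (?V + ?T * noise_moment \<nu> B L (Suc k))"
    by (simp add: noise_moment_def nn_integral_cmult nn_integral_add emeasure_space_1
        del: power_Suc)
  finally show ?thesis
    by (subst (asm) ennreal_mult_le_mult_iff) auto
qed

section \<open>Centered isotropic normal distributions\<close>

definition isotropic_normal :: "real \<Rightarrow> (real^'n) measure" where
  "isotropic_normal s = density lborel (\<lambda>v. ennreal (\<Prod>j\<in>UNIV. normal_density 0 s (v $ j)))"

lemma space_isotropic_normal [simp]: "space (isotropic_normal s) = UNIV"
  and sets_isotropic_normal [simp, measurable_cong]: "sets (isotropic_normal s) = sets borel"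
  by (simp_all add: isotropic_normal_def)

lemma isotropic_normal_uminus: "isotropic_normal (- s) = isotropic_normal s"
  by (simp add: isotropic_normal_def normal_density_def)

lemma distr_isotropic_normal_scaleR:
  assumes s: "s \<noteq> 0"
  shows "distr (isotropic_normal 1) borel ((*\<^sub>R) s) = (isotropic_normal s :: (real^'n) measure)"
proof -
  define p where "p s v = (\<Prod>j\<in>UNIV. normal_density 0 s (v $ j))" for s and v :: "real^'n"
  have p_nonneg: "0 \<le> p s v" for s v
    by (simp add: p_def prod_nonneg)
  have [measurable]: "p s \<in> borel_measurable borel" for s
    unfolding p_def by measurable
  have "std_normal_density x = \<bar>s\<bar> * normal_density 0 s (s * x)" for x
    using s by (simp add: normal_density_def real_sqrt_mult power_mult_distrib)
  then have density: "\<bar>s\<bar> ^ CARD('n) * p s (s *\<^sub>R v) = p 1 v" for v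
    by (simp add: p_def prod.distrib)
  have "isotropic_normal s
      = density (density (distr lborel borel ((*\<^sub>R) s)) (\<lambda>_. \<bar>s\<bar> ^ CARD('n))) (\<lambda>v. ennreal (p s v))"
    using lborel_affine[OF s, of "0 :: real^'n"] by (simp add: isotropic_normal_def p_def)
  also have "\<dots> = density (distr lborel borel ((*\<^sub>R) s)) (\<lambda>v. ennreal (\<bar>s\<bar> ^ CARD('n) * p s v))"
    by (subst density_density_eq) (auto simp: ennreal_mult' p_nonneg)
  also have "\<dots> = distr (density lborel (\<lambda>v. ennreal (p 1 v))) borel ((*\<^sub>R) s)"
    by (subst density_distr) (simp_all add: density)
  finally show ?thesis
    by (simp add: isotropic_normal_def p_def)
qed

lemma nn_integral_lborel_prod_vec:
  fixes f :: "'n::finite \<Rightarrow> real \<Rightarrow> ennreal"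
  assumes [measurable]: "\<And>j. f j \<in> borel_measurable borel"
  shows "(\<integral>\<^sup>+v. (\<Prod>j\<in>UNIV. f j (v $ j)) \<partial>(lborel :: (real^'n) measure))
    = (\<Prod>j\<in>UNIV. \<integral>\<^sup>+x. f j x \<partial>lborel)"
proof -
  let ?e = "\<lambda>j::'n. axis j (1::real)"
  have Basis: "Basis = range ?e" and inj: "inj ?e"
    by (auto simp: Basis_vec_def inj_on_def axis_eq_axis)
  have "(\<integral>\<^sup>+v. (\<Prod>e\<in>Basis. f (inv ?e e) (v \<bullet> e)) \<partial>(lborel :: (real^'n) measure))
      = (\<Prod>e\<in>Basis. \<integral>\<^sup>+x. f (inv ?e e) x \<partial>lborel)"
    by (rule nn_integral_lborel_prod) auto
  then show ?thesis
    by (simp add: Basis prod.reindex[OF inj] inv_f_f[OF inj] cart_eq_inner_axis)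
qed

lemma prob_space_isotropic_normal:
  assumes "0 < s"
  shows "prob_space (isotropic_normal s :: (real^'n) measure)"
proof
  have "(\<integral>\<^sup>+x. ennreal (normal_density 0 s x) \<partial>lborel) = 1"
    using assms by (simp add: nn_integral_eq_integral)
  then show "emeasure (isotropic_normal s :: (real^'n) measure) (space (isotropic_normal s)) = 1"
    using nn_integral_lborel_prod_vec[of "\<lambda>_::'n. \<lambda>x. ennreal (normal_density 0 s x)"]
    by (simp add: isotropic_normal_def emeasure_density prod_ennreal)
qed

lemma symmetric_distribution_isotropic_normal:
  "symmetric_distribution (isotropic_normal 1 :: (real^'n) measure)"
proof -
  interpret prob_space "isotropic_normal 1 :: (real^'n) measure"
    by (rule prob_space_isotropic_normal) simp
  have "uminus = ((*\<^sub>R) (- 1) :: real^'n \<Rightarrow> real^'n)"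
    by (simp add: fun_eq_iff)
  then show ?thesis
    using distr_isotropic_normal_scaleR[of "- 1", where 'n = 'n]
    by unfold_locales (simp_all add: isotropic_normal_uminus)
qed

lemma nn_integral_normal_moment_finite:
  assumes "0 < s"
  shows "(\<integral>\<^sup>+x. ennreal (normal_density 0 s x * (1 + x\<^sup>2) ^ N) \<partial>lborel) < \<infinity>"
proof -
  have "(1 + x\<^sup>2) ^ N = (\<Sum>k\<le>N. real (N choose k) * x ^ (2 * k))" for x :: real
    using binomial_ring[of "x\<^sup>2" 1 N] by (simp add: add.commute power_mult)
  then have "(\<lambda>x. normal_density 0 s x * (1 + x\<^sup>2) ^ N)
      = (\<lambda>x. \<Sum>k\<le>N. real (N choose k) * (normal_density 0 s x * x ^ (2 * k)))"
    by (simp add: fun_eq_iff sum_distrib_left mult_ac)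
  then have "integrable lborel (\<lambda>x. normal_density 0 s x * (1 + x\<^sup>2) ^ N)"
    using integrable_normal_moment[OF assms, of 0] by simp
  then show ?thesis
    by (simp add: nn_integral_eq_integral)
qed

lemma isotropic_normal_moment_finite:
  assumes s: "0 < s"
  shows "(\<integral>\<^sup>+v. ennreal ((1 + (norm v)\<^sup>2) ^ N) \<partial>(isotropic_normal s :: (real^'n) measure)) < \<infinity>"
proof -
  let ?\<nu> = "isotropic_normal s :: (real^'n) measure"
  let ?p = "normal_density 0 s"
  let ?f = "\<lambda>x. ennreal (?p x * (1 + x\<^sup>2) ^ N)"
  have bound: "(\<Prod>j\<in>UNIV. ?p (v $ j)) * (1 + (norm v)\<^sup>2) ^ N
      \<le> 2 ^ N * (\<Prod>j\<in>UNIV. ?p (v $ j) * (1 + (v $ j)\<^sup>2) ^ N)" for v :: "real^'n"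
  proof -
    have "(norm v)\<^sup>2 \<le> (\<Prod>j\<in>UNIV. 1 + (v $ j)\<^sup>2)"
      using sum_le_prod[of UNIV "\<lambda>j. (v $ j)\<^sup>2"] by (simp add: norm_vec_def L2_set_def sum_nonneg)
    moreover have "1 \<le> (\<Prod>j\<in>UNIV. 1 + (v $ j)\<^sup>2)"
      by (intro prod_ge_1) simp
    ultimately have "(1 + (norm v)\<^sup>2) ^ N \<le> (2 * (\<Prod>j\<in>UNIV. 1 + (v $ j)\<^sup>2)) ^ N"
      by (intro power_mono) auto
    then show ?thesis
      by (simp add: prod.distrib power_mult_distrib mult_left_mono prod_nonneg
          mult.left_commute[of "2 ^ N"] flip: prod_power_distrib)
  qed
  have "(\<integral>\<^sup>+v. ennreal ((1 + (norm v)\<^sup>2) ^ N) \<partial>?\<nu>)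
      = (\<integral>\<^sup>+v. ennreal ((\<Prod>j\<in>UNIV. ?p (v $ j)) * (1 + (norm v)\<^sup>2) ^ N)
          \<partial>(lborel :: (real^'n) measure))"
    unfolding isotropic_normal_def
    by (subst nn_integral_density) (auto simp: ennreal_mult' prod_nonneg)
  also have "\<dots> \<le> (\<integral>\<^sup>+v. ennreal (2 ^ N) * (\<Prod>j\<in>UNIV. ?f (v $ j)) \<partial>(lborel :: (real^'n) measure))"
  proof (rule nn_integral_mono)
    fix v :: "real^'n"
    show "ennreal ((\<Prod>j\<in>UNIV. ?p (v $ j)) * (1 + (norm v)\<^sup>2) ^ N)
        \<le> ennreal (2 ^ N) * (\<Prod>j\<in>UNIV. ?f (v $ j))"
      using ennreal_leI[OF bound[of v]] by (subst prod_ennreal) (simp_all flip: ennreal_mult')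
  qed
  also have "\<dots> = ennreal (2 ^ N) * (\<integral>\<^sup>+x. ?f x \<partial>lborel) ^ CARD('n)"
    by (subst nn_integral_cmult) (simp_all add: nn_integral_lborel_prod_vec[of "\<lambda>_. ?f"])
  also have "\<dots> < \<infinity>"
    using nn_integral_normal_moment_finite[OF s, of N]
    by (simp add: ennreal_mult_less_top power_less_top_ennreal)
  finally show ?thesis .
qed

lemma noise_moment_isotropic_normal_finite:
  assumes s: "0 < s" and B: "0 \<le> B"
  shows "noise_moment (isotropic_normal s :: (real^'n) measure) B L m < \<infinity>"
proof -
  let ?\<nu> = "isotropic_normal s :: (real^'n) measure"
  let ?a = "4 * real m + 1"
  define D where "D = 1 + B + ?a * L\<^sup>2"
  have D: "0 \<le> D" using B by (simp add: D_def)
  have "1 + B + ?a * (L * norm z)\<^sup>2 \<le> D * (1 + (norm z)\<^sup>2)" for z :: "real^'n"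
    using mult_nonneg_nonneg[OF B zero_le_power2[of "norm z"]]
    by (simp add: D_def power_mult_distrib algebra_simps)
  then have "ennreal ((1 + B + ?a * (L * norm z)\<^sup>2) ^ m)
      \<le> ennreal (D ^ m) * ennreal ((1 + (norm z)\<^sup>2) ^ m)" for z :: "real^'n"
    using B D by (simp add: ennreal_leI power_mono flip: ennreal_mult' power_mult_distrib)
  then have "noise_moment ?\<nu> B L m
      \<le> (\<integral>\<^sup>+z. ennreal (D ^ m) * ennreal ((1 + (norm z)\<^sup>2) ^ m) \<partial>?\<nu>)"
    unfolding noise_moment_def by (intro nn_integral_mono)
  also have "\<dots> = ennreal (D ^ m) * (\<integral>\<^sup>+z. ennreal ((1 + (norm z)\<^sup>2) ^ m) \<partial>?\<nu>)"
    by (rule nn_integral_cmult) measurable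
  also have "\<dots> < \<infinity>"
    using isotropic_normal_moment_finite[OF s, of m, where 'n = 'n]
    by (simp add: ennreal_mult_less_top)
  finally show ?thesis .
qed

section \<open>Measurability and independence in random recursions\<close>

lemma borel_measurable_left_inverse:
  fixes \<phi> :: "'a::euclidean_space \<Rightarrow> 'b::t2_space"
  assumes cont: "continuous_on UNIV \<phi>" and inj: "inj \<phi>"
  obtains g where "g \<in> borel_measurable borel" "\<And>u. g (\<phi> u) = u"
proof -
  have closed_image: "\<phi> ` C \<in> sets borel" if "closed C" for C
  proof -
    have "C = (\<Union>n::nat. C \<inter> cball 0 (real n))"
      by auto (meson real_arch_simple)
    then have "\<phi> ` C = (\<Union>n::nat. \<phi> ` (C \<inter> cball 0 (real n)))"
      by (metis image_UN)
    also have "\<dots> \<in> sets borel"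
      using that by (intro sets.countable_UN image_subsetI borel_compact compact_continuous_image
          closed_Int_compact compact_cball continuous_on_subset[OF cont]) auto
    finally show ?thesis .
  qed
  define g where "g y = (if y \<in> range \<phi> then inv \<phi> y else 0)" for y
  have "g -` S \<in> sets borel" if "open S" for S
  proof -
    have "g -` S = - \<phi> ` (- S) \<inter> (if 0 \<in> S then UNIV else range \<phi>)"
      using inj by (auto simp: g_def inj_image_mem_iff split: if_splits)
    also have "\<dots> \<in> sets borel"
      using closed_image[OF closed_Compl[OF that]] closed_image[of UNIV] by auto
    finally show ?thesis .
  qed
  then have "g \<in> borel_measurable borel"
    by (intro borel_measurableI) simp
  moreover have "g (\<phi> u) = u" for u
    using inj by (simp add: g_def)
  ultimately show thesis by (rule that)
qed

text \<open>Unlike \<^term>\<open>prob_space.indep_var\<close>, this allows the two variables to have different types.\<close>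

definition (in prob_space) indep_pair ::
    "'b measure \<Rightarrow> ('a \<Rightarrow> 'b) \<Rightarrow> 'c measure \<Rightarrow> ('a \<Rightarrow> 'c) \<Rightarrow> bool" where
  "indep_pair S X T Y \<longleftrightarrow> X \<in> M \<rightarrow>\<^sub>M S \<and> Y \<in> M \<rightarrow>\<^sub>M T \<and>
    distr M S X \<Otimes>\<^sub>M distr M T Y = distr M (S \<Otimes>\<^sub>M T) (\<lambda>\<omega>. (X \<omega>, Y \<omega>))"

lemma (in prob_space) indep_pair_compose:
  assumes indep: "indep_var S X T Y" and [measurable]: "F \<in> S \<rightarrow>\<^sub>M S'" "G \<in> T \<rightarrow>\<^sub>M T'"
  shows "indep_pair S' (\<lambda>\<omega>. F (X \<omega>)) T' (\<lambda>\<omega>. G (Y \<omega>))"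
proof -
  have [measurable]: "X \<in> M \<rightarrow>\<^sub>M S" "Y \<in> M \<rightarrow>\<^sub>M T"
    and joint: "distr M S X \<Otimes>\<^sub>M distr M T Y = distr M (S \<Otimes>\<^sub>M T) (\<lambda>\<omega>. (X \<omega>, Y \<omega>))"
    using indep unfolding indep_var_distribution_eq by auto
  have "sigma_finite_measure (distr (distr M T Y) T' G)"
    by (intro prob_space_imp_sigma_finite prob_space.prob_space_distr prob_space_distr) measurable
  then have "distr (distr M S X) S' F \<Otimes>\<^sub>M distr (distr M T Y) T' G
      = distr (distr M S X \<Otimes>\<^sub>M distr M T Y) (S' \<Otimes>\<^sub>M T') (\<lambda>(x, y). (F x, G y))"
    by (intro pair_measure_distr) measurable
  then show ?thesis
    by (simp add: indep_pair_def joint distr_distr comp_def)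
qed

lemma (in prob_space) nn_integral_indep_pair:
  assumes indep: "indep_pair S X T Y" and f [measurable]: "f \<in> borel_measurable (S \<Otimes>\<^sub>M T)"
  shows "(\<integral>\<^sup>+\<omega>. f (X \<omega>, Y \<omega>) \<partial>M) = (\<integral>\<^sup>+\<omega>. \<integral>\<^sup>+y. f (X \<omega>, y) \<partial>distr M T Y \<partial>M)"
proof -
  have [measurable]: "X \<in> M \<rightarrow>\<^sub>M S" "Y \<in> M \<rightarrow>\<^sub>M T"
    and joint: "distr M S X \<Otimes>\<^sub>M distr M T Y = distr M (S \<Otimes>\<^sub>M T) (\<lambda>\<omega>. (X \<omega>, Y \<omega>))"
    using indep unfolding indep_pair_def by auto
  interpret Y: prob_space "distr M T Y" by (rule prob_space_distr) measurable
  have "(\<integral>\<^sup>+\<omega>. f (X \<omega>, Y \<omega>) \<partial>M) = (\<integral>\<^sup>+p. f p \<partial>(distr M S X \<Otimes>\<^sub>M distr M T Y))"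
    unfolding joint by (simp add: nn_integral_distr)
  also have "\<dots> = (\<integral>\<^sup>+x. \<integral>\<^sup>+y. f (x, y) \<partial>distr M T Y \<partial>distr M S X)"
    by (rule Y.nn_integral_fst[symmetric]) measurable
  also have "\<dots> = (\<integral>\<^sup>+\<omega>. \<integral>\<^sup>+y. f (X \<omega>, y) \<partial>distr M T Y \<partial>M)"
    by (rule nn_integral_distr) measurable
  finally show ?thesis .
qed

lemma random_recursion_factorization:
  assumes g: "g \<in> S \<Otimes>\<^sub>M N \<rightarrow>\<^sub>M S" and x: "x \<in> space S"
    and X_0: "\<And>\<omega>. \<omega> \<in> \<Omega> \<Longrightarrow> X 0 \<omega> = x"
    and X_Suc: "\<And>n \<omega>. \<omega> \<in> \<Omega> \<Longrightarrow> X (Suc n) \<omega> = g (X n \<omega>, \<xi> n \<omega>)"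
  shows "\<exists>F \<in> PiM {..<n} (\<lambda>_. N) \<rightarrow>\<^sub>M S. \<forall>\<omega>\<in>\<Omega>. X n \<omega> = F (\<lambda>i\<in>{..<n}. \<xi> i \<omega>)"
proof (induction n)
  case 0
  show ?case using x X_0 by (intro bexI[of _ "\<lambda>_. x"]) auto
next
  case (Suc n)
  then obtain F where [measurable]: "F \<in> PiM {..<n} (\<lambda>_. N) \<rightarrow>\<^sub>M S"
    and F: "\<forall>\<omega>\<in>\<Omega>. X n \<omega> = F (\<lambda>i\<in>{..<n}. \<xi> i \<omega>)" ..
  have [measurable]: "(\<lambda>y. restrict y {..<n}) \<in> PiM {..<Suc n} (\<lambda>_. N) \<rightarrow>\<^sub>M PiM {..<n} (\<lambda>_. N)"
    by (rule measurable_restrict_subset) auto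
  note g [measurable]
  let ?F' = "\<lambda>y. g (F (restrict y {..<n}), y n)"
  have "X (Suc n) \<omega> = ?F' (\<lambda>i\<in>{..<Suc n}. \<xi> i \<omega>)" if "\<omega> \<in> \<Omega>" for \<omega>
    using that F by (simp add: X_Suc Int_absorb1 lessThan_subset_iff)
  then have "\<forall>\<omega>\<in>\<Omega>. X (Suc n) \<omega> = ?F' (\<lambda>i\<in>{..<Suc n}. \<xi> i \<omega>)" ..
  moreover have "?F' \<in> PiM {..<Suc n} (\<lambda>_. N) \<rightarrow>\<^sub>M S"
    by measurable
  ultimately show ?case by (rule bexI[where x = ?F'])
qed

lemma (in prob_space) indep_pair_random_recursion:
  assumes indep: "indep_vars (\<lambda>_. N) \<xi> UNIV"
    and g: "g \<in> S \<Otimes>\<^sub>M N \<rightarrow>\<^sub>M S" and x: "x \<in> space S"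
    and X_0: "\<And>\<omega>. \<omega> \<in> space M \<Longrightarrow> X 0 \<omega> = x"
    and X_Suc: "\<And>n \<omega>. \<omega> \<in> space M \<Longrightarrow> X (Suc n) \<omega> = g (X n \<omega>, \<xi> n \<omega>)"
  shows "indep_pair S (X n) N (\<xi> n)"
proof -
  obtain F where F: "F \<in> PiM {..<n} (\<lambda>_. N) \<rightarrow>\<^sub>M S"
    and X_eq: "\<forall>\<omega>\<in>space M. X n \<omega> = F (\<lambda>i\<in>{..<n}. \<xi> i \<omega>)"
    using random_recursion_factorization[of g S N x "space M" X \<xi> n, OF g x X_0 X_Suc] by blast
  have "(\<lambda>y. y n) \<in> PiM {n} (\<lambda>_. N) \<rightarrow>\<^sub>M N"
    by (rule measurable_component_singleton) simp
  then have "indep_pair S (\<lambda>\<omega>. F (\<lambda>i\<in>{..<n}. \<xi> i \<omega>)) N (\<lambda>\<omega>. (\<lambda>i\<in>{n}. \<xi> i \<omega>) n)"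
    by (intro indep_pair_compose[OF indep_var_restrict[OF indep] F]) auto
  then show ?thesis
    using X_eq unfolding indep_pair_def by (simp cong: measurable_cong distr_cong)
qed

section \<open>Moments of the backward Euler scheme\<close>

lemma ennreal_contractive_recursion_le:
  fixes v :: "nat \<Rightarrow> ennreal"
  assumes \<delta>: "\<delta> < \<infinity>" and step: "\<And>n. (1 + 2 * \<delta>) * v (Suc n) \<le> (1 + \<delta>) * v n + \<delta> * y"
  shows "v n \<le> v 0 + y"
proof (induction n)
  case (Suc n)
  have "(1 + 2 * \<delta>) * v (Suc n) \<le> (1 + \<delta>) * v n + \<delta> * y" by (rule step)
  also have "\<dots> \<le> (1 + \<delta>) * (v 0 + y) + \<delta> * (v 0 + y)"
    by (intro add_mono mult_left_mono Suc.IH) auto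
  also have "\<dots> = (1 + 2 * \<delta>) * (v 0 + y)"
    by (simp add: distrib_right mult_2 add.assoc)
  finally show ?case
    using \<delta> by (subst (asm) ennreal_mult_le_mult_iff) (auto simp: ennreal_mult_eq_top_iff)
qed simp

lemma (in prob_space) nn_integral_powr_le_even_moment:
  assumes [measurable]: "Y \<in> borel_measurable M"
    and Y: "\<And>\<omega>. 0 \<le> Y \<omega>" and l: "1 \<le> l" and C: "0 \<le> C" and r: "0 \<le> r" "r \<le> 2 * real m"
    and moment: "(\<integral>\<^sup>+\<omega>. ennreal ((1 + (Y \<omega>)\<^sup>2) ^ m) \<partial>M) \<le> ennreal (C * (l\<^sup>2) ^ m)"
  shows "(\<integral>\<^sup>+\<omega>. ennreal (Y \<omega> powr r) \<partial>M) \<le> ennreal ((C + 1) * l powr r)"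
proof -
  let ?p = "r - 2 * real m"
  have l_even: "(l\<^sup>2) ^ m = l powr (2 * real m)"
    using l powr_realpow[of l "2 * m"] by (simp add: power_mult)
  have "(\<integral>\<^sup>+\<omega>. ennreal (Y \<omega> powr r) \<partial>M)
      \<le> (\<integral>\<^sup>+\<omega>. ennreal (l powr ?p) * ennreal ((1 + (Y \<omega>)\<^sup>2) ^ m) + ennreal (l powr r) \<partial>M)"
    using powr_le_even_power[OF Y l r]
    by (intro nn_integral_mono) (simp add: ennreal_leI flip: ennreal_mult' ennreal_plus)
  also have "\<dots> = ennreal (l powr ?p) * (\<integral>\<^sup>+\<omega>. ennreal ((1 + (Y \<omega>)\<^sup>2) ^ m) \<partial>M) + ennreal (l powr r)"
    by (simp add: nn_integral_add nn_integral_cmult emeasure_space_1)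
  also have "\<dots> \<le> ennreal (l powr ?p) * ennreal (C * (l\<^sup>2) ^ m) + ennreal (l powr r)"
    by (intro add_right_mono mult_left_mono moment) auto
  also have "\<dots> = ennreal (C * (l powr ?p * l powr (2 * real m)) + l powr r)"
    using C by (simp add: l_even mult_ac flip: ennreal_mult' ennreal_plus)
  also have "\<dots> = ennreal ((C + 1) * l powr r)"
    by (simp add: algebra_simps flip: powr_add)
  finally show ?thesis .
qed

locale backward_euler = prob_space M + noise: symmetric_distribution \<nu>
  for M :: "'s measure" and \<nu> :: "'b::euclidean_space measure" +
  fixes b :: "'a::euclidean_space \<Rightarrow> 'a" and G :: "'a \<Rightarrow> 'b \<Rightarrow> 'a" and c L \<tau> :: real
    and \<xi> :: "nat \<Rightarrow> 's \<Rightarrow> 'b" and x :: 'a and X :: "nat \<Rightarrow> 's \<Rightarrow> 'a"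
  assumes c_pos: "0 < c" and \<tau>_pos: "0 < \<tau>" and \<tau>_le_1: "\<tau> \<le> 1"
    and dissipative: "strongly_dissipative c b" and b_continuous: "continuous_on UNIV b"
    and G_measurable [measurable]: "case_prod G \<in> borel_measurable (borel \<Otimes>\<^sub>M borel)"
    and G_linear: "linear (G u)" and G_bounded: "norm (G u z) \<le> L * norm z"
    and noise_indep: "indep_vars (\<lambda>_. borel) \<xi> UNIV"
    and noise_distr: "distr M borel (\<xi> n) = distr \<nu> borel ((*\<^sub>R) (sqrt \<tau>))"
    and X_0: "\<omega> \<in> space M \<Longrightarrow> X 0 \<omega> = x"
    and X_Suc: "\<omega> \<in> space M \<Longrightarrow> X (Suc n) \<omega> = X n \<omega> + \<tau> *\<^sub>R b (X (Suc n) \<omega>) + G (X n \<omega>) (\<xi> n \<omega>)"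
begin

abbreviation V :: "nat \<Rightarrow> 's \<Rightarrow> real" where
  "V n \<omega> \<equiv> 1 + (norm (X n \<omega>))\<^sup>2"

abbreviation V_moment :: "nat \<Rightarrow> nat \<Rightarrow> ennreal" where
  "V_moment n m \<equiv> (\<integral>\<^sup>+\<omega>. ennreal (V n \<omega> ^ m) \<partial>M)"

abbreviation noise_const :: "nat \<Rightarrow> ennreal" where
  "noise_const m \<equiv> noise_moment \<nu> (dissipation_offset c b) L m"

lemma implicit_part_eq_explicit_part:
  assumes "\<omega> \<in> space M"
  shows "X (Suc n) \<omega> - \<tau> *\<^sub>R b (X (Suc n) \<omega>) = X n \<omega> + G (X n \<omega>) (\<xi> n \<omega>)"
  using X_Suc[OF assms, of n] by (metis add.commute add.left_commute add_diff_cancel_left')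

lemma indep_pair_state_noise: "indep_pair borel (X n) borel (\<xi> n)"
proof -
  have cont: "continuous_on UNIV (\<lambda>u. u - \<tau> *\<^sub>R b u)"
    by (intro continuous_intros b_continuous)
  have inj: "inj (\<lambda>u. u - \<tau> *\<^sub>R b u)"
    using c_pos \<tau>_pos by (intro strongly_dissipative_implicit_step_inj[OF _ _ dissipative]) auto
  obtain g where [measurable]: "g \<in> borel_measurable borel" and g: "\<And>u. g (u - \<tau> *\<^sub>R b u) = u"
    using borel_measurable_left_inverse[OF cont inj] by blast
  show ?thesis
  proof (rule indep_pair_random_recursion[where X = X and x = x])
    show "(\<lambda>(u, z). g (u + G u z)) \<in> borel \<Otimes>\<^sub>M borel \<rightarrow>\<^sub>M borel"
      by measurable
    show "X (Suc n) \<omega> = (\<lambda>(u, z). g (u + G u z)) (X n \<omega>, \<xi> n \<omega>)" if "\<omega> \<in> space M" for n \<omega>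
      using g[of "X (Suc n) \<omega>"] by (simp add: implicit_part_eq_explicit_part[OF that])
  qed (simp_all add: noise_indep X_0)
qed

lemma X_measurable [measurable]: "X n \<in> borel_measurable M"
  using indep_pair_state_noise by (simp add: indep_pair_def)

lemma V_Suc_power_le:
  assumes \<omega>: "\<omega> \<in> space M"
  shows "(1 + c * \<tau>) * V (Suc n) \<omega> ^ Suc k
    \<le> (1 + (norm (X n \<omega> + G (X n \<omega>) (\<xi> n \<omega>)))\<^sup>2 + \<tau> * dissipation_offset c b) ^ Suc k"
proof -
  have c\<tau>: "0 \<le> c * \<tau>" using c_pos \<tau>_pos by simp
  have "(1 + c * \<tau>) * V (Suc n) \<omega> ^ Suc k \<le> (1 + c * \<tau>) ^ Suc k * V (Suc n) \<omega> ^ Suc k"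
    using c\<tau> by (intro mult_right_mono self_le_power) auto
  also have "\<dots> = ((1 + c * \<tau>) * V (Suc n) \<omega>) ^ Suc k"
    by (rule power_mult_distrib[symmetric])
  also have "\<dots> \<le> (1 + (norm (X n \<omega> + G (X n \<omega>) (\<xi> n \<omega>)))\<^sup>2 + \<tau> * dissipation_offset c b) ^ Suc k"
    using strongly_dissipative_implicit_step_le[OF c_pos _ dissipative, of \<tau> "X (Suc n) \<omega>"] c\<tau> \<tau>_pos
    by (intro power_mono) (simp_all add: implicit_part_eq_explicit_part[OF \<omega>])
  finally show ?thesis .
qed

lemma V_moment_Suc_le:
  "ennreal (1 + c * \<tau>) * V_moment (Suc n) (Suc k)
    \<le> (\<integral>\<^sup>+\<omega>. ennreal (V n \<omega> ^ Suc k)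
        + ennreal (\<tau> * V n \<omega> ^ k) * noise_const (Suc k) \<partial>M)"
proof -
  let ?B = "dissipation_offset c b"
  define h where "h p = ennreal ((1 + (norm (fst p + case_prod G p))\<^sup>2 + \<tau> * ?B) ^ Suc k)" for p
  have [measurable]: "h \<in> borel_measurable (borel \<Otimes>\<^sub>M borel)"
    unfolding h_def by measurable
  have "ennreal (1 + c * \<tau>) * V_moment (Suc n) (Suc k)
      = (\<integral>\<^sup>+\<omega>. ennreal ((1 + c * \<tau>) * V (Suc n) \<omega> ^ Suc k) \<partial>M)"
    using c_pos \<tau>_pos
    by (subst nn_integral_cmult[symmetric]) (auto simp: ennreal_mult' simp del: power_Suc)
  also have "\<dots> \<le> (\<integral>\<^sup>+\<omega>. h (X n \<omega>, \<xi> n \<omega>) \<partial>M)"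
    unfolding h_def fst_conv prod.case by (intro nn_integral_mono ennreal_leI V_Suc_power_le)
  also have "\<dots> = (\<integral>\<^sup>+\<omega>. \<integral>\<^sup>+z. h (X n \<omega>, z) \<partial>distr M borel (\<xi> n) \<partial>M)"
    by (rule nn_integral_indep_pair[OF indep_pair_state_noise]) measurable
  also have "\<dots> = (\<integral>\<^sup>+\<omega>. \<integral>\<^sup>+z. h (X n \<omega>, sqrt \<tau> *\<^sub>R z) \<partial>\<nu> \<partial>M)"
    unfolding noise_distr by (simp add: nn_integral_distr)
  also have "\<dots> \<le> (\<integral>\<^sup>+\<omega>. ennreal (V n \<omega> ^ Suc k)
        + ennreal (\<tau> * V n \<omega> ^ k) * noise_const (Suc k) \<partial>M)"
    unfolding h_def fst_conv prod.case using \<tau>_pos \<tau>_le_1 c_pos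
    by (intro nn_integral_mono noise.linear_increment_moment_le G_linear G_bounded
        dissipation_offset_nonneg) auto
  finally show ?thesis .
qed

lemma V_power_noise_const_le:
  assumes K: "0 \<le> K" "noise_const (Suc k) \<le> ennreal K"
  shows "ennreal (\<tau> * V n \<omega> ^ k) * noise_const (Suc k)
    \<le> ennreal (c * \<tau> / 2) * (ennreal ((2 * K / c) ^ Suc k) + ennreal (V n \<omega> ^ Suc k))"
proof -
  define y where "y = 2 * K / c"
  have y: "0 \<le> y" using c_pos K by (simp add: y_def)
  have c\<tau>: "0 \<le> c * \<tau> / 2" using c_pos \<tau>_pos by simp
  have "\<tau> * V n \<omega> ^ k * K = c * \<tau> / 2 * (y * V n \<omega> ^ k)"
    using c_pos by (simp add: y_def)
  also have "\<dots> \<le> c * \<tau> / 2 * (y ^ Suc k + V n \<omega> ^ Suc k)"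
    using c\<tau> y by (intro mult_left_mono mult_power_le_power_Suc_add) auto
  finally have real_bound: "\<tau> * V n \<omega> ^ k * K \<le> c * \<tau> / 2 * (y ^ Suc k + V n \<omega> ^ Suc k)" .
  have "ennreal (\<tau> * V n \<omega> ^ k) * noise_const (Suc k) \<le> ennreal (\<tau> * V n \<omega> ^ k) * ennreal K"
    by (intro mult_left_mono K) auto
  also have "\<dots> = ennreal (\<tau> * V n \<omega> ^ k * K)"
    using \<tau>_pos by (simp add: ennreal_mult')
  also have "\<dots> \<le> ennreal (c * \<tau> / 2 * (y ^ Suc k + V n \<omega> ^ Suc k))"
    by (rule ennreal_leI[OF real_bound])
  also have "\<dots> = ennreal (c * \<tau> / 2) * (ennreal (y ^ Suc k) + ennreal (V n \<omega> ^ Suc k))"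
    unfolding ennreal_mult'[OF c\<tau>] using y by (subst ennreal_plus) auto
  finally show ?thesis unfolding y_def .
qed

lemma V_moment_recursion:
  assumes K: "0 \<le> K" "noise_const (Suc k) \<le> ennreal K"
  defines "\<delta> \<equiv> ennreal (c * \<tau> / 2)" and "y \<equiv> ennreal ((2 * K / c) ^ Suc k)"
  shows "(1 + 2 * \<delta>) * V_moment (Suc n) (Suc k) \<le> (1 + \<delta>) * V_moment n (Suc k) + \<delta> * y"
proof -
  have "1 + 2 * \<delta> = ennreal (1 + c * \<tau>)"
    using c_pos \<tau>_pos by (simp add: \<delta>_def ennreal_plus flip: ennreal_mult' ennreal_numeral)
  then have "(1 + 2 * \<delta>) * V_moment (Suc n) (Suc k)
      \<le> (\<integral>\<^sup>+\<omega>. ennreal (V n \<omega> ^ Suc k) + ennreal (\<tau> * V n \<omega> ^ k) * noise_const (Suc k) \<partial>M)"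
    using V_moment_Suc_le by simp
  also have "\<dots> \<le> (\<integral>\<^sup>+\<omega>. ennreal (V n \<omega> ^ Suc k) + \<delta> * (y + ennreal (V n \<omega> ^ Suc k)) \<partial>M)"
    unfolding \<delta>_def y_def by (intro nn_integral_mono add_left_mono V_power_noise_const_le K)
  also have "\<dots> = V_moment n (Suc k) + \<delta> * (y + V_moment n (Suc k))"
    by (simp add: nn_integral_add nn_integral_cmult emeasure_space_1 del: power_Suc)
  also have "\<dots> = (1 + \<delta>) * V_moment n (Suc k) + \<delta> * y"
    by (simp add: distrib_left distrib_right ac_simps)
  finally show ?thesis .
qed

lemma V_moment_le:
  assumes K: "0 \<le> K" "noise_const (Suc k) \<le> ennreal K"
  shows "V_moment n (Suc k) \<le> ennreal ((1 + (norm x)\<^sup>2) ^ Suc k + (2 * K / c) ^ Suc k)"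
proof -
  have "V_moment n (Suc k) \<le> V_moment 0 (Suc k) + ennreal ((2 * K / c) ^ Suc k)"
    by (rule ennreal_contractive_recursion_le[where v = "\<lambda>n. V_moment n (Suc k)",
        OF _ V_moment_recursion[OF K]]) simp
  also have "V_moment 0 (Suc k) = (\<integral>\<^sup>+\<omega>. ennreal ((1 + (norm x)\<^sup>2) ^ Suc k) \<partial>M)"
    by (intro nn_integral_cong) (simp add: X_0)
  also have "\<dots> = ennreal ((1 + (norm x)\<^sup>2) ^ Suc k)"
    by (simp add: emeasure_space_1 del: power_Suc)
  finally show ?thesis
    using K c_pos by (simp add: ennreal_plus del: power_Suc)
qed

lemma powr_moment_le:
  assumes K: "0 \<le> K" "noise_const (Suc k) \<le> ennreal K"
    and r: "0 \<le> r" "r \<le> 2 * real (Suc k)"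
  shows "(\<integral>\<^sup>+\<omega>. ennreal (norm (X n \<omega>) powr r) \<partial>M)
    \<le> ennreal ((2 + (2 * K / c) ^ Suc k) * 2 powr r * (1 + norm x powr r))"
proof -
  define C where "C = (2 * K / c) ^ Suc k"
  define l where "l = 1 + norm x"
  have C: "0 \<le> C" using K c_pos by (simp add: C_def)
  have l: "1 \<le> l" by (simp add: l_def)
  have "1 + (norm x)\<^sup>2 \<le> l\<^sup>2"
    by (simp add: l_def power2_eq_square algebra_simps)
  then have "(1 + (norm x)\<^sup>2) ^ Suc k \<le> (l\<^sup>2) ^ Suc k"
    by (intro power_mono) auto
  moreover have "C * 1 \<le> C * (l\<^sup>2) ^ Suc k"
    using C l by (intro mult_left_mono one_le_power) auto
  ultimately have "(1 + (norm x)\<^sup>2) ^ Suc k + C \<le> (1 + C) * (l\<^sup>2) ^ Suc k"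
    by (simp only: distrib_right mult_1_left mult_1_right add_mono)
  then have "V_moment n (Suc k) \<le> ennreal ((1 + C) * (l\<^sup>2) ^ Suc k)"
    using V_moment_le[OF K, of n] unfolding C_def[symmetric]
    by (rule order.trans[OF _ ennreal_leI, rotated])
  then have "(\<integral>\<^sup>+\<omega>. ennreal (norm (X n \<omega>) powr r) \<partial>M) \<le> ennreal ((1 + C + 1) * l powr r)"
    using C l r by (intro nn_integral_powr_le_even_moment[where m = "Suc k"]) auto
  also have "\<dots> \<le> ennreal ((1 + C + 1) * (2 powr r * (1 + norm x powr r)))"
    unfolding l_def using C r by (intro ennreal_leI mult_left_mono one_plus_powr_le) auto
  finally show ?thesis by (simp add: C_def mult.assoc)
qed

end

section \<open>Brownian noise with matrix coefficients\<close>

lemma hs_norm_eq_norm: "hs_norm A = norm A"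
  by (simp add: hs_norm_def norm_vec_def L2_set_def sum_nonneg)

lemma norm_matrix_vector_mult_le:
  fixes A :: "real^'m^'n"
  shows "norm (A *v x) \<le> norm A * norm x"
proof -
  have "norm (A *v x) = L2_set (\<lambda>i. \<bar>A $ i \<bullet> x\<bar>) UNIV"
    by (simp add: norm_vec_def matrix_mult_dot)
  also have "\<dots> \<le> L2_set (\<lambda>i. norm (A $ i) * norm x) UNIV"
    by (intro L2_set_mono Cauchy_Schwarz_ineq2) auto
  also have "\<dots> = norm A * norm x"
    by (simp add: norm_vec_def L2_set_left_distrib)
  finally show ?thesis .
qed

lemma borel_measurable_matrix_vector_mult:
  fixes \<sigma> :: "'a::{second_countable_topology, t2_space} \<Rightarrow> real^'m^'n"
  assumes "continuous_on UNIV \<sigma>"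
  shows "(\<lambda>(u, z). \<sigma> u *v z) \<in> borel_measurable (borel \<Otimes>\<^sub>M borel)"
proof -
  have "continuous_on UNIV (\<lambda>(u, z). \<sigma> u *v z)"
    unfolding matrix_mult_dot case_prod_beta
    by (intro continuous_intros continuous_on_compose2[OF assms]) auto
  then show ?thesis
    unfolding borel_prod by (rule borel_measurable_continuous_onI)
qed

lemma distr_brownian_increment:
  assumes BM: "std_brownian_motion M W" and st: "0 \<le> s" "s < t"
  shows "distr M borel (\<lambda>\<omega>. W t \<omega> - W s \<omega>) = isotropic_normal (sqrt (t - s))"
proof -
  have "distributed M lborel (\<lambda>\<omega>. W t \<omega> - W s \<omega>)
      (\<lambda>v. ennreal (\<Prod>j\<in>UNIV. normal_density 0 (sqrt (t - s)) (v $ j)))"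
    using BM st by (simp add: std_brownian_motion_def)
  then have "distr M lborel (\<lambda>\<omega>. W t \<omega> - W s \<omega>) = isotropic_normal (sqrt (t - s))"
    by (simp add: isotropic_normal_def distributed_def)
  then show ?thesis by (simp cong: distr_cong)
qed

lemma indep_vars_brownian_increments:
  assumes BM: "std_brownian_motion M W" and t: "0 \<le> t 0" "\<And>i. t i < t (Suc i)"
  shows "prob_space.indep_vars M (\<lambda>_. borel) (\<lambda>i \<omega>. W (t (Suc i)) \<omega> - W (t i) \<omega>) UNIV"
proof -
  interpret prob_space M using BM by (simp add: std_brownian_motion_def)
  have initial: "indep_vars (\<lambda>_. borel) (\<lambda>i \<omega>. W (t (Suc i)) \<omega> - W (t i) \<omega>) {..<n}" for n
    using BM t unfolding std_brownian_motion_def by blast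
  have finite: "indep_vars (\<lambda>_. borel) (\<lambda>i \<omega>. W (t (Suc i)) \<omega> - W (t i) \<omega>) J" if "finite J" for J
    using indep_vars_subset[OF initial] finite_nat_bounded[OF that] by blast
  show ?thesis
    using finite finite[of "{i}" for i] unfolding indep_vars_def
    by (subst indep_sets_finite_index_sets) auto
qed

lemma brownian_backward_euler:
  fixes b :: "real^'d \<Rightarrow> real^'d" and \<sigma> :: "real^'d \<Rightarrow> real^'D^'d" and W :: "real \<Rightarrow> 'a \<Rightarrow> real^'D"
  assumes BM: "std_brownian_motion M W" and c: "0 < c" and \<tau>: "0 < \<tau>" "\<tau> \<le> 1"
    and b: "strongly_dissipative c b" "continuous_on UNIV b"
    and \<sigma>: "continuous_on UNIV \<sigma>" "\<And>u. norm (\<sigma> u) \<le> L"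
    and X_0: "\<forall>\<omega>\<in>space M. X 0 \<omega> = x"
    and X_Suc: "\<forall>n. \<forall>\<omega>\<in>space M. X (Suc n) \<omega> = X n \<omega> + \<tau> *\<^sub>R b (X (Suc n) \<omega>)
      + \<sigma> (X n \<omega>) *v (W (real (Suc n) * \<tau>) \<omega> - W (real n * \<tau>) \<omega>)"
  shows "backward_euler M (isotropic_normal 1) b (\<lambda>u. (*v) (\<sigma> u)) c L \<tau>
    (\<lambda>n \<omega>. W (real (Suc n) * \<tau>) \<omega> - W (real n * \<tau>) \<omega>) x X"
proof -
  interpret prob_space M using BM by (simp add: std_brownian_motion_def)
  interpret noise: symmetric_distribution "isotropic_normal 1 :: (real^'D) measure"
    by (rule symmetric_distribution_isotropic_normal)
  show ?thesis
  proof
    show "norm (\<sigma> u *v z) \<le> L * norm z" for u z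
      by (rule order.trans[OF norm_matrix_vector_mult_le mult_right_mono[OF \<sigma>(2)]]) simp
    show "distr M borel (\<lambda>\<omega>. W (real (Suc n) * \<tau>) \<omega> - W (real n * \<tau>) \<omega>)
        = distr (isotropic_normal 1) borel ((*\<^sub>R) (sqrt \<tau>))" for n
      using distr_brownian_increment[OF BM, of "real n * \<tau>" "real (Suc n) * \<tau>"] \<tau>
      by (simp add: distr_isotropic_normal_scaleR algebra_simps)
    show "indep_vars (\<lambda>_. borel) (\<lambda>n \<omega>. W (real (Suc n) * \<tau>) \<omega> - W (real n * \<tau>) \<omega>) UNIV"
      using indep_vars_brownian_increments[OF BM, of "\<lambda>n. real n * \<tau>"] \<tau> by simp
  qed (use assms borel_measurable_matrix_vector_mult in \<open>auto simp: algebra_simps\<close>)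
qed

theorem theorem4p1:
  fixes b :: "real^'d \<Rightarrow> real^'d" and \<sigma> :: "real^'d \<Rightarrow> real^'D^'d"
    and M :: "'a measure" and W :: "real \<Rightarrow> 'a \<Rightarrow> real^'D"
    and L1 L2 L3 c1 q r :: real
  assumes A1a: "L1 > 0" and A1b: "L2 > 0"
    and A1c: "\<forall>u1 u2. hs_norm (\<sigma> u1 - \<sigma> u2) \<le> L1 * norm (u1 - u2)"
    and A1d: "\<forall>u. hs_norm (\<sigma> u) \<le> L2"
    and A2a: "c1 > 15/2 * L1^2" and A2b: "L3 > 0" and A2c: "q \<ge> 1"
    and A2d: "\<forall>u1 u2. inner (u1 - u2) (b u1 - b u2) \<le> - c1 * (norm (u1 - u2))^2"
    and A2e: "\<forall>u1 u2. norm (b u1 - b u2)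
                \<le> L3 * (1 + rpow (norm u1) (q - 1) + rpow (norm u2) (q - 1)) * norm (u1 - u2)"
    and BM: "std_brownian_motion M W"
    and r: "r \<ge> 1"
  shows "\<exists>K>0. \<forall>(\<tau>::real) (x::real^'d) (X::nat \<Rightarrow> 'a \<Rightarrow> real^'d).
           0 < \<tau> \<longrightarrow> \<tau> \<le> 1 \<longrightarrow>
           (\<forall>\<omega>\<in>space M. X 0 \<omega> = x) \<longrightarrow>
           (\<forall>n. \<forall>\<omega>\<in>space M. X (Suc n) \<omega> =
               X n \<omega> + \<tau> *\<^sub>R b (X (Suc n) \<omega>)
               + \<sigma> (X n \<omega>) *v (W (real (Suc n) * \<tau>) \<omega> - W (real n * \<tau>) \<omega>)) \<longrightarrow>
           (\<forall>n. (\<integral>\<^sup>+\<omega>. ennreal (norm (X n \<omega>) powr r) \<partial>M)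
                  \<le> ennreal (K * (1 + norm x powr r)))"
proof -
  have c: "0 < c1" using A2a zero_le_power2[of L1] by linarith
  have b: "strongly_dissipative c1 b" "continuous_on UNIV b"
    using A2c A2d A2e continuous_on_polynomially_lipschitz[of "q - 1" b L3]
    by (auto simp: strongly_dissipative_def)
  have \<sigma>: "continuous_on UNIV \<sigma>" "\<And>u. norm (\<sigma> u) \<le> L2"
    using A1a A1c A1d lipschitz_on_continuous_on[OF lipschitz_onI, of UNIV \<sigma> L1]
    by (auto simp: dist_norm hs_norm_eq_norm)
  obtain k where "r \<le> real k" using real_arch_simple by blast
  then have k: "r \<le> 2 * real (Suc k)" by simp
  let ?\<nu> = "isotropic_normal 1 :: (real^'D) measure"
  have "noise_moment ?\<nu> (dissipation_offset c1 b) L2 (Suc k) < \<infinity>"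
    using c by (intro noise_moment_isotropic_normal_finite dissipation_offset_nonneg) auto
  then obtain K where K: "0 \<le> K" "noise_moment ?\<nu> (dissipation_offset c1 b) L2 (Suc k) \<le> ennreal K"
    by (metis infinity_ennreal_def less_top_ennreal order.refl)
  show ?thesis
  proof (intro exI[of _ "(2 + (2 * K / c1) ^ Suc k) * 2 powr r"] conjI allI impI,
      goal_cases positive moment)
    case positive
    show ?case using K c by (simp add: add_pos_nonneg)
  next
    case (moment \<tau> x X n)
    from brownian_backward_euler[OF BM c moment(1,2) b \<sigma> moment(3,4)]
    show ?case using K r k by (intro backward_euler.powr_moment_le) auto
  qed
qed

end
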